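(* Let $\lambda$ be a regular infinite cardinal and $S\subseteq E^{\lambda^+}_\lambda$ a stationary set such that $\diamondsuit^*(S)$ holds. Set $\Omega:=E^{\lambda^+}_\lambda$ and $\mathcal S:=\{S'\subseteq S\mid S'\text{ stationary}\}$. Then: (1) $\mathrm P^-_\lambda(\lambda^+,2,{}^\Omega_\lambda{\sqsubseteq},1,\mathcal S,2,{<}\infty)$ holds; (2) if moreover $\lambda^{<\lambda}=\lambda$, then $\mathrm P^-_\lambda(\lambda^+,\infty,{}^\Omega{\sqsubseteq},1,\mathcal S,2,{<}\infty)$ holds.
   Context: $E^{\lambda^+}_\lambda:=\{\alpha<\lambda^+\mid\mathrm{cf}(\alpha)=\lambda\}$. $\diamondsuit^*(S)$: there is $\langle\mathcal A_\alpha\mid\alpha\in S\rangle$ with $\mathcal A_\alpha\subseteq\mathcal P(\alpha)$ and $|\mathcal A_\alpha|\le|\alpha|$, such that for every $A\subseteq\lambda^+$ there is a club $D\subseteq\lambda^+$ with $A\cap\alpha\in\mathcal A_\alpha$ for all $\alpha\in D\cap S$. Let $\kappa:=\lambda^+$. Notation: $\mathrm{acc}(C):=\{\alpha\in C\mid\sup(C\cap\alpha)=\alpha>0\}$; $C(j)$ is the $j$-th element of $C$; $\mathrm{succ}_\sigma(C):=\{C(j+1)\mid j<\sigma,\ j+1<\mathrm{otp}(C)\}$; $\mathrm{acc}(\kappa)$ is the set of nonzero limit ordinals below $\kappa$. $\mathcal K(\kappa)$ is the set of nonempty $x\subseteq\kappa$ club in $\sup(x)$ with $\sup(x)\notin x$;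 $\alpha_C:=\sup(C)$. Relations: $C\,{}^\Omega{\sqsubseteq}\,D$ iff ($C=D\cap\alpha_C$ and $\alpha_C\notin\Omega$); $C\,{}^\Omega_\lambda{\sqsubseteq}\,D$ iff (($C=D\cap\alpha_C$ or $\mathrm{cf}(\alpha_C)<\lambda$) and $\alpha_C\notin\Omega$). $\mathrm P^-_\xi(\kappa,\mu,\mathcal R,1,\mathcal S,2,{<}\infty)$ asserts the existence of $\langle\mathcal C_\alpha\mid\alpha<\kappa\rangle$ such that for every $\alpha\in\mathrm{acc}(\kappa)$: $\mathcal C_\alpha\subseteq\{C\in\mathcal K(\kappa)\mid\mathrm{otp}(C)\le\xi,\ \alpha_C=\alpha\}$; $0<|\mathcal C_\alpha|<\mu$ (for $\mu=\infty$: $0<|\mathcal C_\alpha|\le|\alpha|$); for all $C\in\mathcal C_\alpha$ and $\bar\alpha\in\mathrm{acc}(C)$ there is $D\in\mathcal C_{\bar\alpha}$ with $D\,\mathcal R\,C$; and for every cofinal $B\subseteq\kappa$ and every $S'\in\mathcal S$, there are stationarily many $\alpha\in S'$ with $|\mathcal C_\alpha|=1$ such that for all $C\in\mathcal C_\alpha$ and every $\sigma<\mathrm{otp}(C)$, $\sup\{\gamma\in C\mid\mathrm{succ}_\sigma(C\setminus\gamma)\subseteq B\}=\alpha$. *)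

theory Defs
  imports Main
begin

unbundle cardinal_syntax

text \<open>
  Ordinals are the elements of an arbitrary type of class \<open>wellorder\<close>; the von Neumann ordinal
  \<open>a\<close>, as a set, is \<open>{..<a}\<close>. All sets to which \<open>osup\<close>, \<open>otp\<close>, \<open>nth_elem\<close> are applied are bounded,
  so the operators are well defined there.
\<close>

definition ozero :: "'o::wellorder" where
  "ozero = (LEAST x. True)"

definition osuc :: "'o::wellorder \<Rightarrow> 'o" where
  "osuc a = (LEAST x. a < x)"

definition osup :: "'o::wellorder set \<Rightarrow> 'o" where
  "osup X = (LEAST b. \<forall>a\<in>X. a \<le> b)"

definition otp :: "'o::wellorder set \<Rightarrow> 'o" where
  "otp X = (THE d. \<exists>f. strict_mono_on {..<d} f \<and> f ` {..<d} = X)"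

definition nth_elem :: "'o::wellorder set \<Rightarrow> 'o \<Rightarrow> 'o" where
  "nth_elem X j = (THE x. x \<in> X \<and> otp (X \<inter> {..<x}) = j)"

definition is_cardinal :: "'o::wellorder \<Rightarrow> bool" where
  "is_cardinal k \<longleftrightarrow> (\<forall>b<k. |{..<b}| <o |{..<k}| )"

definition is_succ_cardinal :: "'o::wellorder \<Rightarrow> 'o \<Rightarrow> bool" where
  "is_succ_cardinal l k \<longleftrightarrow>
     is_cardinal k \<and> l < k \<and> (\<forall>m. is_cardinal m \<and> l < m \<longrightarrow> k \<le> m)"

definition cofinal_in :: "'o::wellorder set \<Rightarrow> 'o \<Rightarrow> bool" where
  "cofinal_in X d \<longleftrightarrow> X \<subseteq> {..<d} \<and> (\<forall>b<d. \<exists>a\<in>X. b \<le> a)"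

definition cf :: "'o::wellorder \<Rightarrow> 'o" where
  "cf a = (LEAST b. \<exists>X. cofinal_in X a \<and> otp X = b)"

definition regular_infinite_cardinal :: "'o::wellorder \<Rightarrow> bool" where
  "regular_infinite_cardinal l \<longleftrightarrow> is_cardinal l \<and> infinite {..<l} \<and> cf l = l"

definition club_in :: "'o::wellorder set \<Rightarrow> 'o \<Rightarrow> bool" where
  "club_in X d \<longleftrightarrow> cofinal_in X d \<and>
     (\<forall>b<d. ozero < b \<and> osup (X \<inter> {..<b}) = b \<longrightarrow> b \<in> X)"

definition stationary_in :: "'o::wellorder set \<Rightarrow> 'o \<Rightarrow> bool" where
  "stationary_in X d \<longleftrightarrow> X \<subseteq> {..<d} \<and> (\<forall>D. club_in D d \<longrightarrow> X \<inter> D \<noteq> {})"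

definition E_cof :: "'o::wellorder \<Rightarrow> 'o \<Rightarrow> 'o set" where
  "E_cof k l = {a. a < k \<and> cf a = l}"

definition diamond_star :: "'o::wellorder \<Rightarrow> 'o set \<Rightarrow> bool" where
  "diamond_star k S \<longleftrightarrow>
     (\<exists>\<A> :: 'o \<Rightarrow> 'o set set.
        (\<forall>a\<in>S. \<A> a \<subseteq> Pow {..<a} \<and> |\<A> a| \<le>o |{..<a}| ) \<and>
        (\<forall>A. A \<subseteq> {..<k} \<longrightarrow>
           (\<exists>D. club_in D k \<and> (\<forall>a\<in>D \<inter> S. A \<inter> {..<a} \<in> \<A> a))))"

text \<open>The cardinal \<open>l\<close> to the power \<open><l\<close>, as the size of the set of all functions from some
  \<open>b < l\<close> to \<open>l\<close> (tagged by their domain).\<close>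

definition lt_self_power :: "'o::wellorder \<Rightarrow> ('o \<times> ('o \<Rightarrow> 'o)) rel" where
  "lt_self_power l = |SIGMA b:{..<l}. Func {..<b} {..<l}|"

text \<open>The set of nonzero limit ordinals below \<open>k\<close> is \<open>acc_pts {..<k}\<close>.\<close>

definition acc_pts :: "'o::wellorder set \<Rightarrow> 'o set" where
  "acc_pts C = {a \<in> C. osup (C \<inter> {..<a}) = a \<and> ozero < a}"

definition succ_set :: "'o::wellorder \<Rightarrow> 'o set \<Rightarrow> 'o set" where
  "succ_set s C = {nth_elem C (osuc j) | j. j < s \<and> osuc j < otp C}"

definition K_sets :: "'o::wellorder \<Rightarrow> 'o set set" where
  "K_sets k = {x. x \<noteq> {} \<and> x \<subseteq> {..<k} \<and> club_in x (osup x) \<and> osup x \<notin> x}"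

definition end_ext :: "'o::wellorder set \<Rightarrow> 'o set \<Rightarrow> 'o set \<Rightarrow> bool" where
  "end_ext Om C D \<longleftrightarrow> C = D \<inter> {..<osup C} \<and> osup C \<notin> Om"

definition end_ext_below :: "'o::wellorder \<Rightarrow> 'o set \<Rightarrow> 'o set \<Rightarrow> 'o set \<Rightarrow> bool" where
  "end_ext_below l Om C D \<longleftrightarrow>
     (C = D \<inter> {..<osup C} \<or> cf (osup C) < l) \<and> osup C \<notin> Om"

text \<open>The width parameter is \<open>Some m\<close> for a cardinal \<open>m\<close> and \<open>None\<close> for infinity.\<close>

definition width_ok :: "'o::wellorder option \<Rightarrow> 'o \<Rightarrow> 'o set set \<Rightarrow> bool" where
  "width_ok mu a X \<longleftrightarrow> X \<noteq> {} \<and>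
     (case mu of Some m \<Rightarrow> |X| <o |{..<m}| | None \<Rightarrow> |X| \<le>o |{..<a}| )"

definition P_minus ::
  "'o::wellorder \<Rightarrow> 'o \<Rightarrow> 'o option \<Rightarrow> ('o set \<Rightarrow> 'o set \<Rightarrow> bool) \<Rightarrow> 'o set set \<Rightarrow> bool" where
  "P_minus xi k mu R SS \<longleftrightarrow>
     (\<exists>\<C> :: 'o \<Rightarrow> 'o set set.
        (\<forall>a\<in>acc_pts {..<k}.
           \<C> a \<subseteq> {C \<in> K_sets k. otp C \<le> xi \<and> osup C = a} \<and>
           width_ok mu a (\<C> a) \<and>
           (\<forall>C\<in>\<C> a. \<forall>b\<in>acc_pts C. \<exists>D\<in>\<C> b. R D C)) \<and>
        (\<forall>B S'. cofinal_in B k \<and> S' \<in> SS \<longrightarrow>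
           stationary_in
             {a \<in> S'. card (\<C> a) = 1 \<and>
                (\<forall>C\<in>\<C> a. \<forall>s < otp C.
                   osup {g \<in> C. succ_set s (C - {..<g}) \<subseteq> B} = a)} k))"

end

theory Submission
  imports Defs
begin

text \<open>
  For \<open>a\<close> of cofinality \<open>lam\<close>, enumerate in type \<open>lam\<close> all tasks \<open>(A, s, t)\<close> with \<open>A\<close> a cofinal member of
  the \<open>a\<close>-th diamond set, \<open>s < lam\<close> and \<open>t < a\<close>. For each task in turn choose, above \<open>t\<close> and all earlier
  choices, a block of \<open>s + 1\<close> elements of \<open>A\<close>; fewer than \<open>lam\<close> blocks are bounded in \<open>a\<close>. In the closure
  \<open>C\<close> of the union of the blocks all successor elements belong to blocks, so the first \<open>s\<close> successors
  after the minimum of the block of \<open>(A, s, t)\<close> lie in \<open>A\<close>, and \<open>C\<close> has order type at most \<open>lam\<close> by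
  regularity. Every \<open>B\<close> is guessed at club many points of \<open>S\<close>, hence \<open>C\<close> hits \<open>B\<close> there. Accumulation
  points of a club of order type at most \<open>lam\<close> have cofinality below \<open>lam\<close>: this is the weak coherence,
  and under \<open>lam^{<lam} = lam\<close> there is room for all clubs of type below \<open>lam\<close> at such points, which
  gives full coherence.
\<close>

section \<open>Suprema, limit points and clubs in an arbitrary well-order\<close>

lemma ozero_le [simp]: "ozero \<le> a"
  unfolding ozero_def by (simp add: Least_le)

text \<open>The type may have a largest element, where the \<open>LEAST\<close> in
  \<open>osuc\<close> has no witness; the point \<open>b\<close> above \<open>a\<close> provides
  one.\<close>

lemma osuc_props:
  assumes "a < b"
  shows "a < osuc a" and "osuc a \<le> b" and "c < osuc a \<longleftrightarrow> c \<le> a"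
proof -
  show 1: "a < osuc a" unfolding osuc_def by (rule LeastI[of _ b]) (rule assms)
  show "osuc a \<le> b" unfolding osuc_def by (rule Least_le) (rule assms)
  have "c \<le> a" if "c < osuc a"
    using not_less_Least[of c "\<lambda>x. a < x"] that unfolding osuc_def by (simp add: not_less)
  then show "c < osuc a \<longleftrightarrow> c \<le> a" using 1 by auto
qed

lemma osup_eqI:
  assumes "\<And>x. x \<in> X \<Longrightarrow> x \<le> a" and "\<And>b. b < a \<Longrightarrow> \<exists>x\<in>X. b < x"
  shows "osup X = a"
  unfolding osup_def
proof (rule Least_equality)
  show "\<forall>x\<in>X. x \<le> a" using assms(1) by blast
  show "a \<le> b" if "\<forall>x\<in>X. x \<le> b" for b
    using assms(2)[of b] that by (meson leD not_le)
qed

text \<open>An order-theoretic form of \<open>osup (X \<inter> {..<a}) = a\<close> that is visibly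
  monotone in \<open>X\<close>; \<open>limit_of UNIV a\<close> says that \<open>a\<close> is a
  nonzero limit ordinal. Zero is excluded explicitly, because the second clause holds there
  vacuously.\<close>

definition limit_of :: "'o::wellorder set \<Rightarrow> 'o \<Rightarrow> bool" where
  "limit_of X a \<longleftrightarrow> ozero < a \<and> (\<forall>b<a. \<exists>x\<in>X. b < x \<and> x < a)"

lemma limit_of_iff: "limit_of X a \<longleftrightarrow> ozero < a \<and> osup (X \<inter> {..<a}) = a"
proof
  assume "limit_of X a"
  then show "ozero < a \<and> osup (X \<inter> {..<a}) = a"
    unfolding limit_of_def by (auto intro!: osup_eqI)
next
  assume a: "ozero < a \<and> osup (X \<inter> {..<a}) = a"
  have "\<exists>x\<in>X. b < x \<and> x < a" if "b < a" for b
  proof (rule ccontr)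
    assume "\<not> ?thesis"
    then have "\<forall>x\<in>X \<inter> {..<a}. x \<le> b" by (auto simp: not_less)
    then have "osup (X \<inter> {..<a}) \<le> b" unfolding osup_def by (rule Least_le)
    with a that show False by simp
  qed
  then show "limit_of X a" using a unfolding limit_of_def by blast
qed

lemma limit_of_mono: "limit_of X a \<Longrightarrow> X \<inter> {..<a} \<subseteq> Y \<Longrightarrow> limit_of Y a"
  unfolding limit_of_def by blast

lemma limit_of_UNIV: "limit_of X a \<Longrightarrow> limit_of UNIV a"
  by (rule limit_of_mono) auto

lemma limit_of_limit_of:
  assumes "limit_of {b. limit_of X b} a"
  shows "limit_of X a"
  unfolding limit_of_def
proof (intro conjI allI impI)
  show "ozero < a" using assms unfolding limit_of_def by blast
  fix b assume "b < a"
  then obtain c where c: "limit_of X c" "b < c" "c < a"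
    using assms unfolding limit_of_def[of _ a] by blast
  then obtain x where "x \<in> X" "b < x" "x < c" unfolding limit_of_def by blast
  with c show "\<exists>x\<in>X. b < x \<and> x < a" by (auto dest: order.strict_trans)
qed

lemma club_in_iff: "club_in X d \<longleftrightarrow> cofinal_in X d \<and> (\<forall>b<d. limit_of X b \<longrightarrow> b \<in> X)"
  unfolding club_in_def limit_of_iff by blast

lemma acc_pts_eq: "acc_pts C = {a \<in> C. limit_of C a}"
  unfolding acc_pts_def limit_of_iff by auto

lemma acc_pts_lessThan: "a \<in> acc_pts {..<k} \<longleftrightarrow> a < k \<and> limit_of UNIV a"
proof
  show "a < k \<and> limit_of UNIV a" if "a \<in> acc_pts {..<k}"
    using that by (auto simp: acc_pts_eq intro: limit_of_UNIV)
  show "a \<in> acc_pts {..<k}" if "a < k \<and> limit_of UNIV a"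
    using that by (auto simp: acc_pts_eq elim: limit_of_mono)
qed

lemma limit_osuc_less:
  assumes "limit_of UNIV a" and "b < a"
  shows "b < osuc b" and "osuc b < a"
proof -
  obtain c where c: "b < c" "c < a" using assms unfolding limit_of_def by blast
  show "b < osuc b" "osuc b < a" using osuc_props[OF c(1)] c(2) by auto
qed

text \<open>\<open>cofinal_in\<close> is stated with \<le> and \<open>limit_of\<close> with <;
  passing from \<open>b\<close> to \<open>osuc b\<close>, which is still below the limit
  \<open>a\<close>, bridges the two.\<close>

lemma cofinal_in_limit_iff:
  assumes "limit_of UNIV a"
  shows "cofinal_in X a \<longleftrightarrow> X \<subseteq> {..<a} \<and> limit_of X a"
proof
  assume X: "cofinal_in X a"
  have "\<exists>x\<in>X. b < x \<and> x < a" if b: "b < a" for b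
  proof -
    obtain x where "x \<in> X" "osuc b \<le> x"
      using X limit_osuc_less[OF assms b] unfolding cofinal_in_def by blast
    moreover from this have "b < x" using limit_osuc_less[OF assms b] by simp
    ultimately show ?thesis using X unfolding cofinal_in_def by auto
  qed
  then show "X \<subseteq> {..<a} \<and> limit_of X a"
    using X assms unfolding cofinal_in_def limit_of_def by blast
next
  show "X \<subseteq> {..<a} \<and> limit_of X a \<Longrightarrow> cofinal_in X a"
    unfolding cofinal_in_def limit_of_def using less_imp_le by blast
qed

lemma osup_cofinal: "limit_of UNIV a \<Longrightarrow> cofinal_in X a \<Longrightarrow> osup X = a"
  by (rule osup_eqI) (auto simp: cofinal_in_limit_iff limit_of_def less_imp_le)

section \<open>Order types\<close>

lemma strict_mono_on_ge:
  fixes f :: "'o::wellorder \<Rightarrow> 'o"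
  assumes f: "strict_mono_on {..<d} f"
  shows "i < d \<Longrightarrow> i \<le> f i"
proof (induction i rule: less_induct)
  case (less i)
  show ?case
  proof (rule ccontr)
    assume "\<not> i \<le> f i"
    then have lt: "f i < i" by simp
    then have "f i \<le> f (f i)" using less by auto
    moreover have "f (f i) < f i"
      using f lt less.prems by (auto simp: strict_mono_on_def)
    ultimately show False by simp
  qed
qed

definition enumerates :: "('o::wellorder \<Rightarrow> 'o) \<Rightarrow> 'o \<Rightarrow> 'o set \<Rightarrow> bool" where
  "enumerates f d X \<longleftrightarrow> strict_mono_on {..<d} f \<and> f ` {..<d} = X"

lemma enumerates_less_iff:
  assumes "enumerates f d X" "i < d" "j < d"
  shows "f i < f j \<longleftrightarrow> i < j"
  using assms unfolding enumerates_def strict_mono_on_def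
  by (metis lessThan_iff linorder_less_linear order.asym)

text \<open>If \<open>e < d\<close>, pulling \<open>p\<close> after \<open>f\<close> back along
  \<open>g\<close> gives an increasing map of \<open>{..<d}\<close> into \<open>{..<e}\<close>. It
  moves \<open>e\<close> downwards, which \<open>strict_mono_on_ge\<close> forbids.\<close>

lemma enumerates_le:
  assumes f: "enumerates f d X" and g: "enumerates g e Y"
    and p: "strict_mono_on X p" "p ` X \<subseteq> Y"
  shows "d \<le> e"
proof (rule ccontr)
  assume "\<not> d \<le> e"
  then have ed: "e < d" by simp
  have "\<exists>j<e. g j = p (f i)" if "i < d" for i
  proof -
    have "p (f i) \<in> g ` {..<e}"
      using that f g p(2) unfolding enumerates_def by auto
    then show ?thesis by (auto simp: image_iff)
  qed
  then obtain h where h: "\<And>i. i < d \<Longrightarrow> h i < e \<and> g (h i) = p (f i)" by metis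
  have "strict_mono_on {..<d} h"
  proof (rule strict_mono_onI)
    fix i j assume ij: "i \<in> {..<d}" "j \<in> {..<d}" "i < j"
    then have "f i < f j" "f i \<in> X" "f j \<in> X"
      using f unfolding enumerates_def strict_mono_on_def by auto
    then have "p (f i) < p (f j)" using p(1) by (auto simp: strict_mono_on_def)
    then have "g (h i) < g (h j)" using h ij by simp
    then show "h i < h j" using enumerates_less_iff[OF g, of "h i" "h j"] h ij by simp
  qed
  from strict_mono_on_ge[OF this ed] h[OF ed] show False using leD by blast
qed

text \<open>The collapse \<open>r\<close> sends each point to the least strict bound of the values
  at earlier elements of \<open>X\<close>. It maps \<open>X\<close> increasingly onto an initial
  segment, and its inverse is the enumeration.\<close>

lemma enumerates_exists:
  fixes X :: "'o::wellorder set"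
  assumes X: "X \<subseteq> {..<b}"
  shows "\<exists>d f. enumerates f d X"
proof -
  define P where "P r x z \<longleftrightarrow> z = (LEAST z. \<forall>y\<in>X. y < x \<longrightarrow> r y < z)" for r :: "'o \<Rightarrow> 'o" and x z
  have "\<exists>r. \<forall>x. P r x (r x)"
  proof (rule dependent_wellorder_choice)
    show "P f x r = P g x r" if "\<And>y. y < x \<Longrightarrow> f y = g y" for r f g x
      using that unfolding P_def by (simp cong: conj_cong imp_cong)
    show "\<exists>r. P f x r" for x f unfolding P_def by blast
  qed
  then obtain r where "\<forall>x. P r x (r x)" by blast
  then have r: "r x = (LEAST z. \<forall>y\<in>X. y < x \<longrightarrow> r y < z)" for x
    unfolding P_def by blast
  have le: "r x \<le> x" for x
  proof (induction x rule: less_induct)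
    case (less x)
    then have "\<forall>y\<in>X. y < x \<longrightarrow> r y < x" using order.strict_trans1 by blast
    then show ?case by (subst r) (rule Least_le)
  qed
  have mono: "r y < r x" if "y \<in> X" "y < x" for x y
  proof -
    have "\<forall>y\<in>X. y < x \<longrightarrow> r y < x" using le order.strict_trans1 by blast
    then have "\<forall>y\<in>X. y < x \<longrightarrow> r y < (LEAST z. \<forall>y\<in>X. y < x \<longrightarrow> r y < z)"
      by (rule LeastI)
    with that show ?thesis unfolding r[of x, symmetric] by blast
  qed
  have down: "z \<in> r ` X" if "x \<in> X" "z < r x" for x z
    using that
  proof (induction x rule: less_induct)
    case (less x)
    have "\<not> (\<forall>y\<in>X. y < x \<longrightarrow> r y < z)"
      using less.prems(2) r[of x] not_less_Least[of z "\<lambda>z. \<forall>y\<in>X. y < x \<longrightarrow> r y < z"] by simp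
    then obtain y where "y \<in> X" "y < x" "z \<le> r y" by (auto simp: not_less)
    then show ?case using less.IH[of y] by (cases "z = r y") auto
  qed
  define d where "d = (LEAST d. d \<notin> r ` X)"
  \<comment> \<open>Boundedness of \<open>X\<close> enters here: as \<open>r x \<le> x\<close>, the
    value \<open>b\<close> is missed, so a least missed value \<open>d\<close> exists in the
    type.\<close>
  have "b \<notin> r ` X"
    using le X by (auto dest!: subsetD simp flip: not_less)
  then have "d \<notin> r ` X" unfolding d_def by (rule LeastI)
  then have im: "r ` X = {..<d}"
  proof -
    have "r x < d" if "x \<in> X" for x
      using \<open>d \<notin> r ` X\<close> down[OF that, of d] that by (metis imageI linorder_less_linear)
    moreover have "z \<in> r ` X" if "z < d" for z
      using not_less_Least that unfolding d_def by blast
    ultimately show ?thesis by auto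
  qed
  have inj: "inj_on r X" using mono by (intro linorder_inj_onI) (auto simp: less_le)
  have "enumerates (inv_into X r) d X"
    unfolding enumerates_def
  proof
    show "strict_mono_on {..<d} (inv_into X r)"
    proof (rule strict_mono_onI)
      fix i j assume ij: "i \<in> {..<d}" "j \<in> {..<d}" "i < j"
      then have "inv_into X r i \<in> X" "r (inv_into X r i) = i"
        "inv_into X r j \<in> X" "r (inv_into X r j) = j"
        by (simp_all add: im[symmetric] inv_into_into f_inv_into_f)
      then show "inv_into X r i < inv_into X r j" using mono ij(3)
        by (metis not_less_iff_gr_or_eq)
    qed
    show "inv_into X r ` {..<d} = X" using inj by (simp add: im[symmetric] inv_into_image_cancel)
  qed
  then show ?thesis by blast
qed

lemma strict_mono_on_id: "strict_mono_on X (\<lambda>x. x)"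
  by (simp add: strict_mono_on_def)

lemma otp_unique: "enumerates f d X \<Longrightarrow> otp X = d"
  unfolding otp_def enumerates_def[symmetric]
proof (rule the_equality)
  assume f: "enumerates f d X"
  then show "\<exists>f. enumerates f d X" by blast
  show "e = d" if e: "\<exists>f. enumerates f e X" for e
  proof -
    obtain g where g: "enumerates g e X" using e by blast
    show ?thesis
      using enumerates_le[OF f g strict_mono_on_id] enumerates_le[OF g f strict_mono_on_id] by simp
  qed
qed

lemma otp_enumerates:
  fixes X :: "'o::wellorder set"
  assumes "X \<subseteq> {..<b}"
  obtains f where "enumerates f (otp X) X"
  using enumerates_exists[OF assms] otp_unique by blast

lemma otp_le:
  fixes X Y :: "'o::wellorder set"
  assumes "X \<subseteq> {..<b}" "Y \<subseteq> {..<c}" "strict_mono_on X p" "p ` X \<subseteq> Y"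
  shows "otp X \<le> otp Y"
proof -
  obtain f g where "enumerates f (otp X) X" "enumerates g (otp Y) Y"
    using otp_enumerates[OF assms(1)] otp_enumerates[OF assms(2)] by metis
  then show ?thesis using enumerates_le assms(3,4) by blast
qed

lemma otp_mono: "X \<subseteq> Y \<Longrightarrow> Y \<subseteq> {..<b} \<Longrightarrow> otp X \<le> otp Y"
  by (rule otp_le[OF _ _ strict_mono_on_id]) auto

lemma otp_lessThan [simp]: "otp {..<d} = d"
  by (rule otp_unique[of "\<lambda>x. x"]) (simp add: enumerates_def strict_mono_on_id)

lemma enumerates_initial:
  assumes f: "enumerates f d X" and j: "j < d"
  shows "enumerates f j (X \<inter> {..<f j})"
proof -
  have "f ` {..<j} = X \<inter> {..<f j}"
  proof
    show "f ` {..<j} \<subseteq> X \<inter> {..<f j}"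
      using f j unfolding enumerates_def strict_mono_on_def by auto
    show "X \<inter> {..<f j} \<subseteq> f ` {..<j}"
    proof
      fix x assume x: "x \<in> X \<inter> {..<f j}"
      then obtain i where "i < d" "x = f i" using f unfolding enumerates_def by blast
      then show "x \<in> f ` {..<j}" using x enumerates_less_iff[OF f _ j] by auto
    qed
  qed
  moreover have "strict_mono_on {..<j} f"

  proof (rule strict_mono_onI)
    fix r s assume "r \<in> {..<j}" "s \<in> {..<j}" "r < s"
    then show "f r < f s" using enumerates_less_iff[OF f, of r s] j by simp
  qed
  ultimately show ?thesis unfolding enumerates_def by blast
qed

lemma enumerates_nth_elem:
  assumes f: "enumerates f d X" and j: "j < d"
  shows "nth_elem X j = f j"
  unfolding nth_elem_def
proof (rule the_equality)
  show "f j \<in> X \<and> otp (X \<inter> {..<f j}) = j"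
    using f j otp_unique[OF enumerates_initial[OF f j]] unfolding enumerates_def by blast
  show "x = f j" if "x \<in> X \<and> otp (X \<inter> {..<x}) = j" for x
  proof -
    from that f obtain i where "i < d" "x = f i" unfolding enumerates_def by blast
    then show ?thesis using that otp_unique[OF enumerates_initial[OF f \<open>i < d\<close>]] by simp
  qed
qed

lemma nth_elem_props:
  assumes "X \<subseteq> {..<b}" and "j < otp X"
  shows "nth_elem X j \<in> X" and "otp (X \<inter> {..<nth_elem X j}) = j"
proof -
  obtain f where f: "enumerates f (otp X) X" using otp_enumerates[OF assms(1)] .
  note n = enumerates_nth_elem[OF f assms(2)]
  show "nth_elem X j \<in> X" using f assms(2) n unfolding enumerates_def by auto
  show "otp (X \<inter> {..<nth_elem X j}) = j"
    using otp_unique[OF enumerates_initial[OF f assms(2)]] n by simp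
qed

lemma image_nth_elem: "X \<subseteq> {..<b} \<Longrightarrow> nth_elem X ` {..<otp X} = X"
  by (erule otp_enumerates) (simp add: enumerates_nth_elem, simp add: enumerates_def)

lemma otp_initial_less:
  assumes "X \<subseteq> {..<b}" and "x \<in> X"
  shows "otp (X \<inter> {..<x}) < otp X"
proof -
  obtain j where "j < otp X" "x = nth_elem X j"
    using image_nth_elem[OF assms(1)] assms(2) by blast
  then show ?thesis using nth_elem_props(2)[OF assms(1)] by simp
qed

lemma card_of_otp:
  assumes "X \<subseteq> {..<b}"
  shows "|X| =o |{..<otp X}|"
proof -
  obtain f where f: "enumerates f (otp X) X" using otp_enumerates[OF assms] .
  then have "bij_betw f {..<otp X} X"
    unfolding enumerates_def bij_betw_def by (simp add: strict_mono_on_imp_inj_on)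
  then show ?thesis using card_of_ordIso ordIso_symmetric by blast
qed

lemma otp_less_of_card:
  assumes "X \<subseteq> {..<b}" and "|X| <o |{..<l}|"
  shows "otp X < l"
proof (rule ccontr)
  assume "\<not> otp X < l"
  then have "|{..<l}| \<le>o |{..<otp X}|" by (intro card_of_mono1) auto
  then have "|{..<l}| \<le>o |X|"
    using card_of_otp[OF assms(1)] ordIso_symmetric ordLeq_ordIso_trans by blast
  with assms(2) show False using not_ordLess_ordLeq by blast
qed

section \<open>Closures and cofinality\<close>

definition oclosure :: "'o::wellorder set \<Rightarrow> 'o \<Rightarrow> 'o set" where
  "oclosure X a = {x. x < a \<and> (x \<in> X \<or> limit_of X x)}"

text \<open>Every added point has elements of \<open>X\<close> arbitrarily close below it, so adding
  limits once already yields a closed set.\<close>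

lemma limit_of_oclosure:
  assumes "limit_of (oclosure X a) b"
  shows "limit_of X b"
  unfolding limit_of_def
proof (intro conjI allI impI)
  show "ozero < b" using assms unfolding limit_of_def by blast
  fix c assume "c < b"
  then obtain y where y: "y \<in> oclosure X a" "c < y" "y < b"
    using assms unfolding limit_of_def by blast
  show "\<exists>x\<in>X. c < x \<and> x < b"
  proof (cases "y \<in> X")
    case False
    then obtain x where "x \<in> X" "c < x" "x < y"
      using y unfolding oclosure_def limit_of_def by blast
    then show ?thesis using y(3) by (auto dest: order.strict_trans)
  qed (use y in blast)
qed

lemma club_in_oclosure:
  assumes "cofinal_in X a"
  shows "club_in (oclosure X a) a"
  unfolding club_in_iff
proof
  show "cofinal_in (oclosure X a) a"
    using assms unfolding cofinal_in_def oclosure_def by blast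
  show "\<forall>b<a. limit_of (oclosure X a) b \<longrightarrow> b \<in> oclosure X a"
    using limit_of_oclosure unfolding oclosure_def by blast
qed

text \<open>Sending a point to the next element of \<open>X\<close> embeds the closure of \<open>X\<close> into \<open>X\<close>.\<close>

lemma otp_oclosure_le:
  assumes a: "limit_of UNIV a" and X: "cofinal_in X a"
  shows "otp (oclosure X a) \<le> otp X"
proof -
  define n where "n x = (LEAST y. y \<in> X \<and> x < y)" for x
  have Xa: "X \<subseteq> {..<a}" "limit_of X a" using X cofinal_in_limit_iff[OF a] by auto
  have n: "n x \<in> X \<and> x < n x" if "x < a" for x
  proof -
    have "\<exists>y. y \<in> X \<and> x < y" using Xa(2) that unfolding limit_of_def by blast
    then show ?thesis unfolding n_def by (rule LeastI_ex)
  qed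
  have "strict_mono_on (oclosure X a) n"
  proof (rule strict_mono_onI)
    fix x y assume xy: "x \<in> oclosure X a" "y \<in> oclosure X a" "x < y"
    have "\<exists>z\<in>X. x < z \<and> z \<le> y"
      using xy(2,3) unfolding oclosure_def limit_of_def by (auto dest: less_imp_le)
    then obtain z where z: "z \<in> X" "x < z" "z \<le> y" by blast
    have "n x \<le> z" unfolding n_def by (rule Least_le) (use z in blast)
    then show "n x < n y" using z(3) n[of y] xy(2) unfolding oclosure_def by auto
  qed
  then show ?thesis
    by (rule otp_le[rotated 2]) (use Xa(1) n in \<open>auto simp: oclosure_def\<close>)
qed

lemma cofinal_above:
  assumes "b < a" "cofinal_in X a"
  shows "cofinal_in (X \<inter> {b..}) a"
proof -
  have "\<exists>x\<in>X \<inter> {b..}. c \<le> x" if "c < a" for c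
  proof -
    have "max b c < a" using assms(1) that by simp
    then obtain x where "x \<in> X" "max b c \<le> x" using assms(2) unfolding cofinal_in_def by blast
    then show ?thesis by auto
  qed
  then show ?thesis using assms(2) unfolding cofinal_in_def by blast
qed

lemma cf_le: "cofinal_in X a \<Longrightarrow> cf a \<le> otp X"
  unfolding cf_def by (rule Least_le) blast

lemma cf_cofinal:
  fixes a :: "'o::wellorder"
  obtains X where "cofinal_in X a" "otp X = cf a"
proof -
  have "cofinal_in {..<a} a" unfolding cofinal_in_def by blast
  then have "\<exists>b X. cofinal_in X a \<and> otp X = b" by blast
  then have "\<exists>X. cofinal_in X a \<and> otp X = cf a" unfolding cf_def by (rule LeastI_ex)
  then show ?thesis using that by blast
qed

text \<open>\<open>cf\<close> is defined by order types of cofinal sets; this passes to arbitrary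
  maps from \<open>{..<m}\<close>, the form in which regularity is applied.\<close>

lemma cf_le_of_image:
  fixes a m :: "'o::wellorder"
  assumes h: "cofinal_in (h ` {..<m}) a"
  shows "cf a \<le> m"
proof -
  \<comment> \<open>Only the values of \<open>h\<close> exceeding all previous ones are kept, so that indices increase with values.\<close>
  define I where "I = {i. i < m \<and> (\<forall>j<i. h j < h i)}"
  have mono: "strict_mono_on I h"
    unfolding I_def by (auto intro!: strict_mono_onI)
  have "cofinal_in (h ` I) a"
    unfolding cofinal_in_def
  proof (intro conjI allI impI)
    show "h ` I \<subseteq> {..<a}" using h unfolding I_def cofinal_in_def by blast
    fix b assume "b < a"
    then have ex: "\<exists>i. i < m \<and> b \<le> h i" using h unfolding cofinal_in_def by blast
    \<comment> \<open>The first index whose value reaches \<open>b\<close> is a record, since all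
      earlier values are below \<open>b\<close>.\<close>
    define i where "i = (LEAST i. i < m \<and> b \<le> h i)"
    have i: "i < m" "b \<le> h i" using LeastI_ex[OF ex] unfolding i_def by auto
    have "h j < h i" if j: "j < i" for j
    proof -
      have "\<not> (j < m \<and> b \<le> h j)"
        using not_less_Least[OF j[unfolded i_def]] .
      then show ?thesis using i j by auto
    qed
    then have "i \<in> I" using i(1) unfolding I_def by blast
    then show "\<exists>x\<in>h ` I. b \<le> x" using i(2) by blast
  qed
  then have "cf a \<le> otp (h ` I)" by (rule cf_le)
  moreover have "otp (h ` I) \<le> otp {..<m}"
  proof (rule otp_le)
    show "h ` I \<subseteq> {..<a}" using h unfolding I_def cofinal_in_def by blast
    show "{..<m} \<subseteq> {..<m}" by simp
    have inj: "inj_on h I" using mono by (rule strict_mono_on_imp_inj_on)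
    show "inv_into I h ` (h ` I) \<subseteq> {..<m}" using inj unfolding I_def by auto
    show "strict_mono_on (h ` I) (inv_into I h)"
    proof (rule strict_mono_onI)
      fix x y assume "x \<in> h ` I" "y \<in> h ` I" "x < y"
      then obtain i j where "i \<in> I" "j \<in> I" "x = h i" "y = h j" "h i < h j" by blast
      moreover from this have "i < j"
        using mono unfolding strict_mono_on_def
        by (metis linorder_less_linear order.asym)
      ultimately show "inv_into I h x < inv_into I h y" using inj by simp
    qed
  qed
  ultimately show ?thesis by simp
qed

lemma bounded_of_less_cf:
  fixes a m :: "'o::wellorder"
  assumes "m < cf a" and "\<And>i. i < m \<Longrightarrow> h i < a"
  obtains y where "y < a" "\<And>i. i < m \<Longrightarrow> h i < y"
proof -
  have "\<not> cofinal_in (h ` {..<m}) a" using cf_le_of_image assms(1) leD by blast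
  then obtain y where "y < a" "\<forall>x\<in>h ` {..<m}. \<not> y \<le> x"
    unfolding cofinal_in_def using assms(2) by blast
  then show ?thesis using that[of y] by (auto simp: not_le)
qed

text \<open>Closing a tail of a cofinal set of minimal type does not raise its type. This supplies
  clubs at points of cofinality below \<open>lam\<close>.\<close>

lemma small_club_exists:
  assumes a: "limit_of UNIV a" "b < a"
  obtains C where "club_in C a" "C \<subseteq> {b..}" "otp C \<le> cf a"
proof -
  obtain X where X: "cofinal_in X a" "otp X = cf a" by (rule cf_cofinal)
  define Y where "Y = X \<inter> {b..}"
  have Y: "cofinal_in Y a" unfolding Y_def by (rule cofinal_above[OF a(2) X(1)])
  show ?thesis
  proof (rule that[of "oclosure Y a"])
    show "club_in (oclosure Y a) a" by (rule club_in_oclosure[OF Y])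
    have "otp Y \<le> otp X"
      using X(1) unfolding Y_def cofinal_in_def by (intro otp_mono[of _ _ a]) auto
    then show "otp (oclosure Y a) \<le> cf a" using otp_oclosure_le[OF a(1) Y] X(2) by simp
    have "b \<le> x" if x: "limit_of Y x" for x
    proof -
      obtain y where "y \<in> Y" "y < x" using x unfolding limit_of_def by blast
      then show ?thesis unfolding Y_def by auto
    qed
    then show "oclosure Y a \<subseteq> {b..}" unfolding oclosure_def Y_def by auto
  qed
qed

lemma club_in_K_sets:
  assumes "limit_of UNIV a" "a < k" "club_in C a"
  shows "C \<in> K_sets k" and "osup C = a"
proof -
  have cof: "cofinal_in C a" using assms(3) unfolding club_in_def by blast
  then show o: "osup C = a" using osup_cofinal assms(1) by blast
  have Ca: "C \<subseteq> {..<a}" using cof unfolding cofinal_in_def by blast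
  have "ozero < a" using assms(1) unfolding limit_of_def by blast
  then have "C \<noteq> {}" using cof unfolding cofinal_in_def by blast
  moreover have "C \<subseteq> {..<k}" using Ca assms(2) by auto
  moreover have "a \<notin> C" using Ca by auto
  ultimately show "C \<in> K_sets k" using assms(3) o unfolding K_sets_def by simp
qed

text \<open>If \<open>s\<close> were the largest element below \<open>l\<close>, then
  \<open>{..<l}\<close> would be the infinite set \<open>{..<s}\<close> with one point added, hence
  no larger than it, although \<open>l\<close> is a cardinal.\<close>

lemma infinite_cardinal_limit:
  assumes "is_cardinal l" and "infinite {..<l}"
  shows "limit_of UNIV l"
  unfolding limit_of_def
proof (intro conjI allI impI)
  have "{..<l} \<noteq> {}" using assms(2) by auto
  then obtain x where "x < l" by auto
  then show "ozero < l" using ozero_le le_less_trans by blast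
  fix s assume s: "s < l"
  show "\<exists>x\<in>UNIV. s < x \<and> x < l"
  proof (rule ccontr)
    assume "\<not> ?thesis"
    then have "{..<l} = {..s}" using s by (auto simp: not_less intro: le_less_trans)
    then have eq: "{..<l} = insert s {..<s}" using ivl_disj_un_singleton(2)[of s] by simp
    then have inf: "infinite {..<s}" using assms(2) by (metis finite_insert)
    have "{..<s} \<noteq> {}" using inf by (metis finite.emptyI)
    then have "|{..<s} \<union> {s}| \<le>o |{..<s}|"
      using inf by (intro card_of_Un_ordLeq_infinite_Field)
        (auto simp: card_of_singl_ordLeq Field_card_of card_of_card_order_on card_of_mono1)
    then have "|{..<l}| \<le>o |{..<s}|" using eq by simp
    moreover have "|{..<s}| <o |{..<l}|" using assms(1) s unfolding is_cardinal_def by blast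
    ultimately show False using not_ordLess_ordLeq by blast
  qed
qed

section \<open>Sizes and cofinalities below \<open>kappa\<close>, and common limit points in
  \<open>kappa\<close>\<close>

locale successor_of_regular =
  fixes lam kappa :: "'o::wellorder"
  assumes regular: "regular_infinite_cardinal lam"
    and successor: "is_succ_cardinal lam kappa"
begin

lemma infinite_lam: "infinite {..<lam}"
  and cf_lam: "cf lam = lam"
  and card_less_lam: "s < lam \<Longrightarrow> |{..<s}| <o |{..<lam}|"
  using regular unfolding regular_infinite_cardinal_def is_cardinal_def by auto

lemma lam_less_kappa: "lam < kappa"
  using successor unfolding is_succ_cardinal_def by blast

lemma card_lam_less: "|{..<lam}| <o |{..<kappa}|"
  using successor unfolding is_succ_cardinal_def is_cardinal_def by blast

text \<open>The least \<open>b\<close> with more than \<open>lam\<close> many predecessors is a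
  cardinal above \<open>lam\<close>, hence at least \<open>kappa\<close>.\<close>

lemma card_le_lam:
  assumes "a < kappa"
  shows "|{..<a}| \<le>o |{..<lam}|"
proof (rule ccontr)
  let ?P = "\<lambda>b::'o. |{..<lam}| <o |{..<b}|"
  assume "\<not> ?thesis"
  then have a: "?P a" using not_ordLeq_iff_ordLess[OF card_of_Well_order card_of_Well_order] by blast
  define b where "b = (LEAST b. ?P b)"
  have b: "?P b" unfolding b_def using LeastI[of ?P a] a by blast
  have small: "|{..<c}| \<le>o |{..<lam}|" if "c < b" for c
    using not_less_Least[of c ?P] that not_ordLeq_iff_ordLess[OF card_of_Well_order card_of_Well_order]
    unfolding b_def by blast
  have "is_cardinal b"
    unfolding is_cardinal_def using small b ordLeq_ordLess_trans by blast
  moreover have "lam < b"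
  proof (rule ccontr)
    assume "\<not> lam < b"
    then have "|{..<b}| \<le>o |{..<lam}|" by (intro card_of_mono1) auto
    then show False using b not_ordLess_ordLeq by blast
  qed
  ultimately have "kappa \<le> b" using successor unfolding is_succ_cardinal_def by blast
  moreover have "b \<le> a" unfolding b_def using Least_le[of ?P a] a by blast
  ultimately show False using assms by simp
qed

lemma lam_limit: "limit_of UNIV lam"
  using regular infinite_cardinal_limit unfolding regular_infinite_cardinal_def by blast

lemma kappa_limit: "limit_of UNIV kappa"
proof (rule infinite_cardinal_limit)
  show "is_cardinal kappa" using successor unfolding is_succ_cardinal_def by blast
  show "infinite {..<kappa}"
    using infinite_lam finite_subset[of "{..<lam}" "{..<kappa}"] less_imp_le[OF lam_less_kappa] by auto
qed

lemma cf_le_lam: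
  assumes "limit_of UNIV a" and "a < kappa"
  shows "cf a \<le> lam"
proof -
  have "{..<a} \<noteq> {}" using assms(1) unfolding limit_of_def by auto
  then obtain h where "h ` {..<lam} = {..<a}"
    using card_le_lam[OF assms(2)] card_of_ordLeq2 by metis
  moreover have "cofinal_in {..<a} a" unfolding cofinal_in_def by blast
  ultimately show ?thesis using cf_le_of_image by metis
qed

text \<open>Countably many initial segments of size at most \<open>lam\<close> cannot cover
  \<open>{..<kappa}\<close>. This fragment of the regularity of \<open>kappa\<close> suffices for
  constructions in omega steps.\<close>

lemma countable_bounded:
  fixes x :: "nat \<Rightarrow> 'o"
  assumes "\<And>n. x n < kappa"
  obtains u where "u < kappa" "\<And>n. x n \<le> u"
proof (rule ccontr)
  assume *: "\<not> thesis"
  have "{..<kappa} \<subseteq> (\<Union>n. {..<x n})"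
  proof
    fix u assume "u \<in> {..<kappa}"
    then have "\<not> (\<forall>n. x n \<le> u)" using * that by auto
    then show "u \<in> (\<Union>n. {..<x n})" by (auto simp: not_le)
  qed
  then have "|{..<kappa}| \<le>o |\<Union>n. {..<x n}|" by (rule card_of_mono1)
  also have "|\<Union>n. {..<x n}| \<le>o |{..<lam}|"
  proof (rule card_of_UNION_ordLeq_infinite[OF infinite_lam])
    show "|UNIV :: nat set| \<le>o |{..<lam}|" using infinite_lam infinite_iff_card_of_nat by blast
    show "\<forall>n\<in>UNIV. |{..<x n}| \<le>o |{..<lam}|" using card_le_lam assms by blast
  qed
  finally show False using card_lam_less not_ordLess_ordLeq by blast
qed

text \<open>Three sets are treated at once because the final argument looks for a common limit of
  the test club, the diamond club and the set to be guessed; \<open>b0\<close> becomes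
  \<open>lam\<close> there.\<close>

lemma common_limits_club:
  assumes B: "cofinal_in B1 kappa" "cofinal_in B2 kappa" "cofinal_in B3 kappa" and b0: "b0 < kappa"
  shows "club_in {a. b0 < a \<and> a < kappa \<and> limit_of B1 a \<and> limit_of B2 a \<and> limit_of B3 a} kappa"
    (is "club_in ?W kappa")
  unfolding club_in_iff
proof
  have lim: "limit_of B1 kappa" "limit_of B2 kappa" "limit_of B3 kappa"
    using B cofinal_in_limit_iff[OF kappa_limit] by auto
  have step: "\<exists>y. x < y \<and> y < kappa \<and> (\<exists>z\<in>B1. x < z \<and> z < y) \<and> (\<exists>z\<in>B2. x < z \<and> z < y) \<and>
      (\<exists>z\<in>B3. x < z \<and> z < y)" if x: "x < kappa" for x
  proof -
    obtain z1 z2 z3 where z: "z1 \<in> B1" "x < z1" "z1 < kappa" "z2 \<in> B2" "x < z2" "z2 < kappa"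
      "z3 \<in> B3" "x < z3" "z3 < kappa"
      using lim x unfolding limit_of_def by meson
    define m where "m = max z1 (max z2 z3)"
    have m: "m < kappa" "z1 \<le> m" "z2 \<le> m" "z3 \<le> m" using z unfolding m_def by (simp_all add: le_max_iff_disj)
    obtain y where y: "m < y" "y < kappa" using kappa_limit m(1) unfolding limit_of_def by blast
    have "z1 < y" "z2 < y" "z3 < y" using m y by auto
    then show ?thesis using y z by (meson order.strict_trans)
  qed
  then obtain f where f: "\<And>x. x < kappa \<Longrightarrow> x < f x \<and> f x < kappa \<and>
      (\<exists>z\<in>B1. x < z \<and> z < f x) \<and> (\<exists>z\<in>B2. x < z \<and> z < f x) \<and> (\<exists>z\<in>B3. x < z \<and> z < f x)"
    by metis
  show "cofinal_in ?W kappa"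
    unfolding cofinal_in_def
  proof (intro conjI allI impI)
    show "?W \<subseteq> {..<kappa}" by blast
    fix b assume b: "b < kappa"
    \<comment> \<open>Each application of \<open>f\<close> jumps over elements of all three sets, so
      the supremum \<open>a\<close> of the iterates is a limit of each of them.\<close>
    define x where "x n = (f ^^ n) (max b b0)" for n :: nat
    have xk: "x n < kappa" for n by (induction n) (use b b0 f in \<open>auto simp: x_def\<close>)
    have xSuc: "x (Suc n) = f (x n)" for n by (simp add: x_def)
    obtain u where u: "u < kappa" "\<And>n. x n \<le> u" using countable_bounded[of x] xk by blast
    define a where "a = (LEAST a. \<forall>n. x n \<le> a)"
    have ub: "x n \<le> a" for n
      unfolding a_def using LeastI[of "\<lambda>a. \<forall>n. x n \<le> a" u] u(2) by blast
    have "a \<le> u" unfolding a_def using u(2) by (simp add: Least_le)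
    have lub: "\<exists>n. c < x n" if "c < a" for c
      using not_less_Least[OF that[unfolded a_def]] by (auto simp: not_le)
    have xa: "x n < a" for n using ub[of "Suc n"] f[OF xk, of n] xSuc by (metis order.strict_trans2)
    have l: "limit_of B' a" if B': "\<And>y. y < kappa \<Longrightarrow> \<exists>z\<in>B'. y < z \<and> z < f y" for B'
      unfolding limit_of_def
    proof (intro conjI allI impI)
      show "ozero < a" using xa[of 0] ozero_le le_less_trans by blast
      fix c assume "c < a"
      then obtain n where n: "c < x n" using lub by blast
      obtain z where "z \<in> B'" "x n < z" "z < f (x n)" using B' xk by blast
      then show "\<exists>z\<in>B'. c < z \<and> z < a"
        using n ub[of "Suc n"] xSuc by (metis order.strict_trans order.strict_trans2)
    qed
    have "limit_of B1 a" "limit_of B2 a" "limit_of B3 a" using f by (blast intro!: l)+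
    moreover have "max b b0 < a" using xa[of 0] by (simp add: x_def)
    ultimately have "a \<in> ?W" "b \<le> a" using \<open>a \<le> u\<close> u(1) by auto
    then show "\<exists>a\<in>?W. b \<le> a" by blast
  qed
  show "\<forall>b<kappa. limit_of ?W b \<longrightarrow> b \<in> ?W"
  proof (intro allI impI)
    fix b assume b: "b < kappa" "limit_of ?W b"
    have "limit_of B' b" if "\<And>x. x \<in> ?W \<Longrightarrow> limit_of B' x" for B'
      by (rule limit_of_limit_of, rule limit_of_mono[OF b(2)]) (use that in blast)
    then have "limit_of B1 b" "limit_of B2 b" "limit_of B3 b" by blast+
    moreover have "b0 < b"
    proof -
      have "ozero < b" using b(2) unfolding limit_of_def by blast
      then obtain w where "w \<in> ?W" "w < b" using b(2) unfolding limit_of_def by blast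
      then show ?thesis by auto
    qed
    ultimately show "b \<in> ?W" using b(1) by blast
  qed
qed

section \<open>A club of order type \<open>lam\<close> guessing a given family\<close>

lemma Times_less_lam:
  assumes "m < lam" and "n < lam"
  shows "|{..<m} \<times> {..<n}| <o |{..<lam}|"
proof -
  define p where "p = max m n"
  have p: "p < lam" "m \<le> p" "n \<le> p" using assms unfolding p_def by (simp_all add: le_max_iff_disj)
  have "{..<m} \<times> {..<n} \<subseteq> {..<p} \<times> {..<p}" using p(2,3) by auto
  then have 1: "|{..<m} \<times> {..<n}| \<le>o |{..<p} \<times> {..<p}|" by (rule card_of_mono1)
  have "|{..<p} \<times> {..<p}| <o |{..<lam}|"
  \<comment> \<open>An infinite set has the size of its square; the finite case is the one that
    occurs when \<open>lam\<close> is omega.\<close>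
  proof (cases "finite {..<p}")
    case True
    then have "finite ({..<p} \<times> {..<p})" by simp
    then have "\<not> |{..<lam}| \<le>o |{..<p} \<times> {..<p}|"
      using infinite_lam card_of_ordLeq_finite by blast
    then show ?thesis using not_ordLeq_iff_ordLess[OF card_of_Well_order card_of_Well_order] by blast
  next
    case False
    then show ?thesis
      using card_of_Times_same_infinite card_less_lam[OF p(1)] ordIso_ordLess_trans by blast
  qed
  with 1 show ?thesis by (rule ordLeq_ordLess_trans)
qed

text \<open>A tail of \<open>A\<close> is cofinal, so its type is at least \<open>cf a = lam\<close>
  and it has an element at index \<open>osuc s\<close>. The elements before that one form the block,
  and it serves itself as the strict bound \<open>y\<close>.\<close>

lemma block_exists:
  assumes a: "limit_of UNIV a" "cf a = lam" and A: "cofinal_in A a" and b: "b < a" and s: "s < lam"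
  obtains T y where "T \<subseteq> A" "T \<subseteq> {b..}" "otp T = osuc s" "y < a" "T \<subseteq> {..<y}"
proof -
  define Y where "Y = A \<inter> {b..}"
  have "cofinal_in Y a" unfolding Y_def by (rule cofinal_above[OF b A])
  then have Ya: "Y \<subseteq> {..<a}" and "lam \<le> otp Y"
    using cf_le[of Y a] a(2) unfolding cofinal_in_def by auto
  then have s1: "osuc s < otp Y" using limit_osuc_less(2)[OF lam_limit s] by simp
  define y where "y = nth_elem Y (osuc s)"
  note n = nth_elem_props[OF Ya s1, folded y_def]
  show ?thesis
  proof (rule that[of "Y \<inter> {..<y}" y])
    show "y < a" using n(1) Ya by blast
    show "otp (Y \<inter> {..<y}) = osuc s" by (rule n(2))
  qed (auto simp: Y_def)
qed

lemma blocks_exist: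
  assumes a: "limit_of UNIV a" "cf a = lam"
    and A: "\<And>i. i < lam \<Longrightarrow> cofinal_in (A i) a"
    and s: "\<And>i. i < lam \<Longrightarrow> s i < lam"
    and t: "\<And>i. i < lam \<Longrightarrow> t i < a"
  obtains T where "\<And>i. i < lam \<Longrightarrow> T i \<subseteq> A i \<and> T i \<subseteq> {t i..} \<and> otp (T i) = osuc (s i)"
    and "\<And>i j x z. i < j \<Longrightarrow> j < lam \<Longrightarrow> x \<in> T i \<Longrightarrow> z \<in> T j \<Longrightarrow> x < z"
proof -
  \<comment> \<open>Recording a bound below \<open>a\<close> for each block lets the next stage find
    a common bound of the earlier blocks, which are fewer than \<open>cf a\<close>. For
    \<open>i \<ge> lam\<close> every set is admissible, so the recursion can run over the whole
    type.\<close>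
  define P where "P f i U \<longleftrightarrow> (i < lam \<longrightarrow> (U \<subseteq> A i \<and> U \<subseteq> {t i..} \<and> otp U = osuc (s i)) \<and>
      (\<exists>y<a. U \<subseteq> {..<y}) \<and> (\<forall>j<i. \<forall>x\<in>f j. \<forall>z\<in>U. x < z))" for f :: "'o \<Rightarrow> 'o set" and i U
  have "\<exists>T. \<forall>i. P T i (T i)"
  proof (rule dependent_wellorder_choice)
    show "P f i U = P g i U" if "\<And>j. j < i \<Longrightarrow> f j = g j" for U f g i
      using that unfolding P_def by (simp cong: conj_cong imp_cong)
    show "\<exists>U. P f i U" if IH: "\<And>j. j < i \<Longrightarrow> P f j (f j)" for i f
    proof (cases "i < lam")
      case True
      have "\<exists>y<a. f j \<subseteq> {..<y}" if "j < i" for j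
        using IH[OF that] order.strict_trans[OF that True] unfolding P_def by blast
      then obtain y where y: "\<And>j. j < i \<Longrightarrow> y j < a \<and> f j \<subseteq> {..<y j}" by metis
      obtain u where u: "u < a" "\<And>j. j < i \<Longrightarrow> y j < u"
        using bounded_of_less_cf[of i a y] a(2) True y by auto
      have "max u (t i) < a" using u(1) t[OF True] by simp
      then obtain U z where U: "U \<subseteq> A i" "U \<subseteq> {max u (t i)..}" "otp U = osuc (s i)" "z < a" "U \<subseteq> {..<z}"
        using block_exists[OF a A[OF True] _ s[OF True]] by metis
      have "x < w" if "j < i" "x \<in> f j" "w \<in> U" for j x w
      proof -
        have "x < y j" using y that by blast
        also have "\<dots> < u" using u(2) that by blast
        also have "u \<le> w" using U(2) that by auto
        finally show ?thesis .
      qed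
      moreover have "U \<subseteq> {t i..}" using U(2) by auto
      ultimately show ?thesis using U unfolding P_def by blast
    qed (simp add: P_def)
  qed
  then obtain T where T: "\<forall>i. P T i (T i)" by blast
  show ?thesis
  proof (rule that[of T])
    show "T i \<subseteq> A i \<and> T i \<subseteq> {t i..} \<and> otp (T i) = osuc (s i)" if "i < lam" for i
      using T that unfolding P_def by blast
    show "x < z" if "i < j" "j < lam" "x \<in> T i" "z \<in> T j" for i j x z
      using T that unfolding P_def by blast
  qed
qed

lemma guessing_club:
  assumes a: "limit_of UNIV a" "a < kappa" "cf a = lam" and b0: "b0 < a"
    and \<A>: "|\<A>| \<le>o |{..<a}|"
  obtains C where "club_in C a" "C \<subseteq> {b0..}" "otp C \<le> lam"
    "\<And>A s b. A \<in> \<A> \<Longrightarrow> cofinal_in A a \<Longrightarrow> s < lam \<Longrightarrow> b < a \<Longrightarrow>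
       \<exists>g\<in>C. b < g \<and> succ_set s (C - {..<g}) \<subseteq> A"
proof -
  have olam: "ozero < lam" using lam_limit unfolding limit_of_def by blast
  \<comment> \<open>Adding \<open>{..<a}\<close> keeps the set of tasks nonempty even if
    \<open>\<A>\<close> has no cofinal member, and its tasks make the union of the blocks cofinal in
    \<open>a\<close>.\<close>
  define \<A>' where "\<A>' = {{..<a}} \<union> {A \<in> \<A>. cofinal_in A a}"
  define Q where "Q = \<A>' \<times> ({..<lam} \<times> {..<a})"
  have full: "cofinal_in {..<a} a" unfolding cofinal_in_def by blast
  have inf: "infinite (Field |{..<lam}| )" using infinite_lam by (simp add: Field_card_of)
  have "|{A \<in> \<A>. cofinal_in A a}| \<le>o |\<A>|" by (rule card_of_mono1) blast
  then have c1: "|{A \<in> \<A>. cofinal_in A a}| \<le>o |{..<lam}|"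
    by (rule ordLeq_transitive[OF ordLeq_transitive[OF _ \<A>] card_le_lam[OF a(2)]])
  have "|{{..<a}}| \<le>o |{..<lam}|" using olam by (intro card_of_singl_ordLeq) blast
  then have "|\<A>'| \<le>o |{..<lam}|"
    unfolding \<A>'_def using c1 by (intro card_of_Un_ordLeq_infinite_Field[OF inf])
      (auto simp: card_of_Card_order card_of_mono1)
  moreover have "|{..<lam} \<times> {..<a}| \<le>o |{..<lam}|"
    using card_le_lam[OF a(2)] by (intro card_of_Times_ordLeq_infinite_Field[OF inf])
      (auto simp: card_of_Card_order card_of_mono1)
  ultimately have Qle: "|Q| \<le>o |{..<lam}|"
    unfolding Q_def by (intro card_of_Times_ordLeq_infinite_Field[OF inf])
      (auto simp: card_of_Card_order card_of_mono1 card_le_lam a(2))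
  have "({..<a}, ozero, b0) \<in> Q" unfolding Q_def \<A>'_def using olam b0 by blast
  then have "Q \<noteq> {}" by blast
  then obtain q where q: "q ` {..<lam} = Q" using card_of_ordLeq2 Qle by metis
  define A where "A i = fst (q i)" for i
  define s where "s i = fst (snd (q i))" for i
  \<comment> \<open>The maximum with \<open>b0\<close> keeps all blocks, and so their closure, at or
    above \<open>b0\<close>.\<close>
  define t where "t i = max b0 (snd (snd (q i)))" for i
  have qi: "q i \<in> Q" if "i < lam" for i using q that by blast
  have A: "cofinal_in (A i) a" if "i < lam" for i
    using qi[OF that] full unfolding A_def Q_def \<A>'_def by auto
  have s: "s i < lam" if "i < lam" for i
    using qi[OF that] unfolding s_def Q_def by auto
  have t: "t i < a" if "i < lam" for i
    using qi[OF that] b0 unfolding t_def Q_def by auto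
  have task: "\<exists>i<lam. A i = A' \<and> s i = s' \<and> t' \<le> t i" if "A' \<in> \<A>'" "s' < lam" "t' < a" for A' s' t'
  proof -
    have "(A', s', t') \<in> q ` {..<lam}" unfolding q using that by (simp add: Q_def)
    then obtain i where "i < lam" "q i = (A', s', t')" by force
    then show ?thesis unfolding A_def s_def t_def by (intro exI[of _ i]) (simp add: le_max_iff_disj)
  qed
  obtain T where T: "\<And>i. i < lam \<Longrightarrow> T i \<subseteq> A i \<and> T i \<subseteq> {t i..} \<and> otp (T i) = osuc (s i)"
    and sep: "\<And>i j x z. i < j \<Longrightarrow> j < lam \<Longrightarrow> x \<in> T i \<Longrightarrow> z \<in> T j \<Longrightarrow> x < z"
    using blocks_exist[of a A s t, OF a(1,3) A s t] by blast
  have suc: "s i < osuc (s i)" "osuc (s i) < lam" if "i < lam" for i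
    using limit_osuc_less[OF lam_limit s[OF that]] .
  have Ta: "T i \<subseteq> {..<a}" if "i < lam" for i
    using T[OF that] A[OF that] unfolding cofinal_in_def by blast
  have Tne: "T i \<noteq> {}" if "i < lam" for i
  proof
    assume "T i = {}"
    moreover have "{..<ozero::'o} = {}" using leD[OF ozero_le] by blast
    then have "otp {} = (ozero::'o)" using otp_lessThan[of "ozero::'o"] by simp
    ultimately show False using T[OF that] suc(1)[OF that] leD[OF ozero_le[of "s i"]] by simp
  qed
  define X where "X = (\<Union>i\<in>{..<lam}. T i)"
  have Xa: "X \<subseteq> {..<a}" using Ta unfolding X_def by blast
  have Xcof: "cofinal_in X a"
    unfolding cofinal_in_def
  proof (intro conjI allI impI Xa)
    fix b assume "b < a"
    then obtain i where i: "i < lam" "b \<le> t i" using task[of "{..<a}" ozero b] olam \<A>'_def by blast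
    obtain x where "x \<in> T i" using Tne i by blast
    moreover from this have "b \<le> x" using T[OF i(1)] i(2) by auto
    ultimately show "\<exists>x\<in>X. b \<le> x" using i unfolding X_def by blast
  qed
  have otpX: "otp X \<le> lam"
  proof (rule ccontr)
    assume "\<not> otp X \<le> lam"
    then have lt: "lam < otp X" by simp
    define x where "x = nth_elem X lam"
    note n = nth_elem_props[OF Xa lt, folded x_def]
    obtain i where i: "i < lam" "x \<in> T i" using n(1) unfolding X_def by blast
    note si = limit_osuc_less[OF lam_limit i(1)]
    have j: "j < lam" if "j < osuc i" for j using that si(2) by (rule order.strict_trans)
    obtain m where m: "m < lam" "\<And>j. j < osuc i \<Longrightarrow> osuc (s j) < m"
      using bounded_of_less_cf[of "osuc i" lam "\<lambda>j. osuc (s j)"] cf_lam si(2) suc(2) j by auto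
    \<comment> \<open>Only the blocks with index up to \<open>i\<close> have elements below
      \<open>x\<close>, whence the range \<open>osuc i\<close>. Regularity of \<open>lam\<close>
      gave the bound \<open>m\<close> on the types of these blocks, so fewer than \<open>lam\<close>
      elements lie below \<open>x\<close>.\<close>
    have "X \<inter> {..<x} \<subseteq> (\<lambda>(j, k). nth_elem (T j) k) ` ({..<osuc i} \<times> {..<m})"
    proof
      fix y assume y: "y \<in> X \<inter> {..<x}"
      then obtain j where jy: "j < lam" "y \<in> T j" unfolding X_def by blast
      have "\<not> i < j" using sep[OF _ jy(1) i(2) jy(2)] y by auto
      then have ji: "j < osuc i" using osuc_props(3)[OF i(1)] by simp
      have "y \<in> nth_elem (T j) ` {..<osuc (s j)}"
        using image_nth_elem[OF Ta[OF jy(1)]] jy T[OF jy(1)] by simp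
      then obtain k where "k < osuc (s j)" "y = nth_elem (T j) k" by blast
      moreover from this have "k < m" using m(2)[OF ji] by (auto intro: order.strict_trans)
      ultimately show "y \<in> (\<lambda>(j, k). nth_elem (T j) k) ` ({..<osuc i} \<times> {..<m})"
        using ji by force
    qed
    then have "|X \<inter> {..<x}| \<le>o |{..<osuc i} \<times> {..<m}|"
      using card_of_mono1 card_of_image ordLeq_transitive by blast
    then have "|X \<inter> {..<x}| <o |{..<lam}|"
      using Times_less_lam[OF si(2) m(1)] ordLeq_ordLess_trans by blast
    then have "otp (X \<inter> {..<x}) < lam" using otp_less_of_card[of "X \<inter> {..<x}" x] by blast
    then show False using n(2) by simp
  qed
  define C where "C = oclosure X a"
  have XC: "X \<subseteq> C" using Xa unfolding C_def oclosure_def by blast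
  have Ca: "C \<subseteq> {..<a}" unfolding C_def oclosure_def by blast
  show ?thesis
  proof (rule that[of C])
    show "club_in C a" unfolding C_def by (rule club_in_oclosure[OF Xcof])
    show "otp C \<le> lam" using otp_oclosure_le[OF a(1) Xcof] otpX unfolding C_def by simp
    have Xb0: "b0 \<le> x" if x: "x \<in> X" for x
    proof -
      obtain i where "i < lam" "x \<in> T i" using x unfolding X_def by blast
      then have "t i \<le> x" using T by auto
      then show ?thesis unfolding t_def by simp
    qed
    show "C \<subseteq> {b0..}"
    proof
      fix x assume x: "x \<in> C"
      show "x \<in> {b0..}"
      proof (cases "x \<in> X")
        case False
        then obtain y where "y \<in> X" "y < x" using x unfolding C_def oclosure_def limit_of_def by blast
        then show ?thesis using Xb0[of y] by auto
      qed (use Xb0 in auto)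
    qed
    fix A' s' b assume A': "A' \<in> \<A>" "cofinal_in A' a" and s': "s' < lam" and b: "b < a"
    note sb = limit_osuc_less[OF a(1) b]
    \<comment> \<open>Asking for \<open>osuc b\<close> instead of \<open>b\<close> puts the minimum
      \<open>g\<close> of the block strictly above \<open>b\<close>.\<close>
    obtain i where i: "i < lam" "A i = A'" "s i = s'" "osuc b \<le> t i"
      using task[of A' s' "osuc b"] A' s' sb unfolding \<A>'_def by blast
    define g where "g = (LEAST g. g \<in> T i)"
    have g: "g \<in> T i" unfolding g_def using Tne[OF i(1)] LeastI_ex[of "\<lambda>g. g \<in> T i"] by blast
    have gmin: "g \<le> x" if "x \<in> T i" for x unfolding g_def using that by (rule Least_le)
    have gC: "g \<in> C" using g i XC unfolding X_def by blast
    have "t i \<le> g" using g T[OF i(1)] by auto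
    then have "b < g" using sb(1) i(4) by simp
    moreover have "succ_set s' (C - {..<g}) \<subseteq> A'"
    proof
      fix x assume "x \<in> succ_set s' (C - {..<g})"
      then obtain j where j: "j < s'" "osuc j < otp (C - {..<g})" "x = nth_elem (C - {..<g}) (osuc j)"
        unfolding succ_set_def by blast
      define D where "D = C - {..<g}"
      have Da: "D \<subseteq> {..<a}" using Ca unfolding D_def by blast
      have x: "x \<in> D" "otp (D \<inter> {..<x}) = osuc j"
        using nth_elem_props[OF Da, of "osuc j"] j unfolding D_def by auto
      have jsuc: "j < osuc j" "osuc j \<le> s'" using osuc_props[OF j(1)] by auto
      \<comment> \<open>The index of \<open>x\<close> in \<open>D\<close> is a successor. A limit of
        \<open>X\<close> would have elements of \<open>X\<close>, hence of \<open>D\<close>, between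
        its predecessor and itself.\<close>
      have "x \<in> X"
      proof (rule ccontr)
        assume "x \<notin> X"
        then have lim: "limit_of X x" using x(1) unfolding D_def C_def oclosure_def by blast
        \<comment> \<open>The \<open>j\<close>-th element of \<open>D\<close> is the predecessor of \<open>x\<close> in \<open>D\<close>.\<close>
        have Dx: "D \<inter> {..<x} \<subseteq> {..<x}" by blast
        define m where "m = nth_elem (D \<inter> {..<x}) j"
        have m: "m \<in> D \<inter> {..<x}" "otp (D \<inter> {..<x} \<inter> {..<m}) = j"
          using nth_elem_props[OF Dx, of j] x(2) jsuc(1) unfolding m_def by auto
        obtain y where y: "y \<in> X" "m < y" "y < x" using lim m(1) unfolding limit_of_def by blast
        have "g \<le> m" using m(1) unfolding D_def by auto
        then have yD: "y \<in> D \<inter> {..<x}" using y XC unfolding D_def by auto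
        have "otp (D \<inter> {..<x} \<inter> {..<m}) < otp (D \<inter> {..<x} \<inter> {..<y})"
        proof -
          have "D \<inter> {..<x} \<inter> {..<m} = (D \<inter> {..<x} \<inter> {..<y}) \<inter> {..<m}" using y by auto
          then show ?thesis
            using otp_initial_less[of "D \<inter> {..<x} \<inter> {..<y}" y m] m(1) y(2) by auto
        qed
        moreover have "otp (D \<inter> {..<x} \<inter> {..<y}) < osuc j"
          using otp_initial_less[OF Dx yD] x(2) by simp
        ultimately show False using m(2) osuc_props(3)[OF j(1)] by auto
      qed
      then obtain k where k: "k < lam" "x \<in> T k" unfolding X_def by blast
      have "\<not> k < i"
      proof
        assume "k < i"
        then have "x < g" using sep i(1) k(2) g by blast
        then show False using x(1) unfolding D_def by auto
      qed
      \<comment> \<open>If \<open>x\<close> were in a later block, all of \<open>T i\<close>, of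
        type \<open>osuc s'\<close>, would lie in the part of \<open>D\<close> below
        \<open>x\<close>, whose type is only \<open>osuc j \<le> s'\<close>. This is where the one
        extra element in each block matters.\<close>
      moreover have "\<not> i < k"
      proof
        assume ik: "i < k"
        have "T i \<subseteq> D \<inter> {..<x}"
        proof
          fix z assume z: "z \<in> T i"
          have "z < x" using sep[OF ik k(1) z k(2)] .
          moreover have "z \<in> C" using z i(1) XC unfolding X_def by blast
          ultimately show "z \<in> D \<inter> {..<x}" using gmin[OF z] unfolding D_def by auto
        qed
        then have "otp (T i) \<le> otp (D \<inter> {..<x})" by (rule otp_mono[of _ _ x]) blast
        then have "osuc s' \<le> osuc j" using T[OF i(1)] i(3) x(2) by simp
        then show False using suc(1)[OF i(1)] i(3) jsuc(2) by simp
      qed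
      ultimately have "k = i" by simp
      then show "x \<in> A'" using k(2) T[OF i(1)] i(2) by blast
    qed
    ultimately show "\<exists>g\<in>C. b < g \<and> succ_set s' (C - {..<g}) \<subseteq> A'" using gC by blast
  qed
qed

section \<open>The coherent family\<close>

text \<open>A set is determined by its order type and its enumeration. An injection of
  \<open>{..<a}\<close> into \<open>{..<lam}\<close> turns the latter into a sequence in
  \<open>lam\<close> of length below \<open>lam\<close>, and \<open>pow\<close> counts these
  sequences.\<close>

lemma card_small_subsets:
  assumes pow: "lt_self_power lam =o |{..<lam}|" and a: "lam \<le> a" "a < kappa"
  shows "|{C. C \<subseteq> {..<a} \<and> otp C < lam}| \<le>o |{..<a}|"
proof -
  let ?N = "{C. C \<subseteq> {..<a} \<and> otp C < lam}"
  obtain h where h: "inj_on h {..<a}" "h ` {..<a} \<subseteq> {..<lam}"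
    using card_le_lam[OF a(2)] card_of_ordLeq by metis
  \<comment> \<open>The value \<open>undefined\<close> outside the domain is the one that
    \<open>Func\<close> demands.\<close>
  define e where
    "e C = (otp C, \<lambda>i. if i < otp C then h (nth_elem C i) else undefined)" for C
  have "inj_on e ?N"
  proof (rule inj_onI)
    fix C D assume CD: "C \<in> ?N" "D \<in> ?N" "e C = e D"
    then have o: "otp C = otp D" unfolding e_def by simp
    have "nth_elem C i = nth_elem D i" if i: "i < otp C" for i
    proof (rule inj_onD[OF h(1)])
      show "h (nth_elem C i) = h (nth_elem D i)"
        using CD(3) i o unfolding e_def by (auto dest: fun_cong[of _ _ i])
      show "nth_elem C i \<in> {..<a}" "nth_elem D i \<in> {..<a}"
        using nth_elem_props(1)[of C a i] nth_elem_props(1)[of D a i] CD i o by auto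
    qed
    then have "nth_elem C ` {..<otp C} = nth_elem D ` {..<otp D}"
      using o by (intro image_cong) auto
    then show "C = D" using image_nth_elem[of C a] image_nth_elem[of D a] CD by simp
  qed
  moreover have "e ` ?N \<subseteq> (SIGMA b:{..<lam}. Func {..<b} {..<lam})"
  proof
    fix p assume "p \<in> e ` ?N"
    then obtain C where C: "C \<subseteq> {..<a}" "otp C < lam" "p = e C" by blast
    have "h (nth_elem C i) \<in> {..<lam}" if "i < otp C" for i
      using nth_elem_props(1)[OF C(1) that] C(1) h(2) by blast
    then show "p \<in> (SIGMA b:{..<lam}. Func {..<b} {..<lam})"
      using C unfolding e_def Func_def by auto
  qed
  ultimately have "|?N| \<le>o lt_self_power lam"
    unfolding lt_self_power_def by (intro card_of_ordLeqI[of e]) auto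
  also have "lt_self_power lam =o |{..<lam}|" by (rule pow)
  also have "|{..<lam}| \<le>o |{..<a}|" using a(1) by (intro card_of_mono1) auto
  finally show ?thesis .
qed

text \<open>\<open>osuc (osuc ozero)\<close> is the ordinal 2, the width in the first claim; its
  elements \<open>ozero\<close> and \<open>osuc ozero\<close> are distinct because
  \<open>kappa\<close> is a limit above them.\<close>

lemma singleton_less_two: "|{x}| <o |{..<osuc (osuc (ozero::'o))}|"
proof -
  have "ozero < kappa" using kappa_limit unfolding limit_of_def by blast
  note z = limit_osuc_less[OF kappa_limit this]
  note o = limit_osuc_less(1)[OF kappa_limit z(2)]
  have "\<not> |{..<osuc (osuc (ozero::'o))}| \<le>o |{x}|"
  proof
    assume "|{..<osuc (osuc (ozero::'o))}| \<le>o |{x}|"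
    then obtain f where f: "inj_on f {..<osuc (osuc (ozero::'o))}" "f ` {..<osuc (osuc ozero)} \<subseteq> {x}"
      using card_of_ordLeq by metis
    have m: "ozero \<in> {..<osuc (osuc (ozero::'o))}" "osuc ozero \<in> {..<osuc (osuc (ozero::'o))}"
      using order.strict_trans[OF z(1) o] o by simp_all
    have "f y = x" if "y \<in> {..<osuc (osuc ozero)}" for y using f(2) that by blast
    then have "f ozero = f (osuc ozero)" using m by simp
    then have "(ozero::'o) = osuc ozero" by (rule inj_onD[OF f(1) _ m])
    then show False using z(1) by simp
  qed
  then show ?thesis using not_ordLeq_iff_ordLess[OF card_of_Well_order card_of_Well_order] by blast
qed

text \<open>Starting at \<open>lam\<close> keeps every accumulation point above \<open>lam\<close>,
  and the bound on \<open>otp C\<close> puts the sets among those counted by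
  \<open>card_small_subsets\<close>. Both conditions pass to initial segments.\<close>

definition small_clubs :: "'o \<Rightarrow> 'o set set" where
  "small_clubs a = {C. club_in C a \<and> C \<subseteq> {lam..} \<and> otp C < lam}"

end

text \<open>Only the shape of the ladders \<open>c a\<close> is fixed here, so coherence and size
  are settled independently of the diamond; guessing enters later as the hypothesis
  \<open>hit\<close>.\<close>

locale ladder_family = successor_of_regular lam kappa for lam kappa :: "'o::wellorder" +
  fixes c :: "'o \<Rightarrow> 'o set"
  assumes c: "\<And>a. limit_of UNIV a \<Longrightarrow> lam < a \<Longrightarrow> a < kappa \<Longrightarrow> cf a = lam \<Longrightarrow>
    club_in (c a) a \<and> c a \<subseteq> {lam..} \<and> otp (c a) \<le> lam"
begin

text \<open>Above \<open>lam\<close> all clubs avoid \<open>lam\<close>, since a limit \<open>a < lam\<close> may have more than \<open>|a|\<close> clubs.\<close>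

definition family :: "'o \<Rightarrow> 'o set set" where
  "family a = (if a \<le> lam then {{..<a}} else if cf a = lam then {c a} else small_clubs a)"

lemma family_club:
  assumes "limit_of UNIV a" "a < kappa" "C \<in> family a"
  shows "club_in C a" and "otp C \<le> lam" and "lam < a \<Longrightarrow> C \<subseteq> {lam..}"
proof -
  have full: "club_in {..<a} a" unfolding club_in_iff cofinal_in_def by blast
  have "club_in C a \<and> otp C \<le> lam \<and> (lam < a \<longrightarrow> C \<subseteq> {lam..})"
  proof (cases "a \<le> lam")
    case True
    then show ?thesis using assms(3) full unfolding family_def by auto
  next
    case False
    then show ?thesis
      using assms c[of a] unfolding family_def small_clubs_def by (auto split: if_splits)
  qed
  then show "club_in C a" "otp C \<le> lam" "lam < a \<Longrightarrow> C \<subseteq> {lam..}" by auto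
qed

lemma family_nonempty:
  assumes "limit_of UNIV a" "a < kappa"
  shows "family a \<noteq> {}"
proof (cases "lam < a \<and> cf a \<noteq> lam")
  case True
  then have "cf a < lam" using cf_le_lam[OF assms] by (simp add: le_less)
  moreover obtain C where "club_in C a" "C \<subseteq> {lam..}" "otp C \<le> cf a"
    using small_club_exists[OF assms(1)] True by blast
  ultimately have "C \<in> small_clubs a" unfolding small_clubs_def by auto
  then show ?thesis using True unfolding family_def by auto
qed (auto simp: family_def)

text \<open>Cutting \<open>C\<close> at one of its elements leaves a type below
  \<open>otp C \<le> lam\<close>. Hence \<open>b\<close> has cofinality below \<open>lam\<close>,
  and above \<open>lam\<close> the cut is one of the small clubs, all of which belong to the family
  at \<open>b\<close>.\<close>

lemma family_coherent:
  assumes a: "limit_of UNIV a" "a < kappa" and C: "C \<in> family a" and b: "b \<in> acc_pts C"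
  shows "C \<inter> {..<b} \<in> family b" and "osup (C \<inter> {..<b}) = b" and "cf b < lam"
    and "limit_of UNIV b" and "b < a"
proof -
  have bC: "b \<in> C" "limit_of C b" using b unfolding acc_pts_eq by auto
  note fc = family_club[OF a C]
  have Ca: "C \<subseteq> {..<a}" using fc(1) unfolding club_in_def cofinal_in_def by blast
  show ba: "b < a" using bC(1) Ca by blast
  show lb: "limit_of UNIV b" using bC(2) by (rule limit_of_UNIV)
  have lim: "limit_of (C \<inter> {..<b}) b" using bC(2) by (rule limit_of_mono) blast
  then have cof: "cofinal_in (C \<inter> {..<b}) b" using cofinal_in_limit_iff[OF lb] by blast
  then show "osup (C \<inter> {..<b}) = b" by (rule osup_cofinal[OF lb])
  have otp: "otp (C \<inter> {..<b}) < lam" using otp_initial_less[OF Ca bC(1)] fc(2) by simp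
  then show cfb: "cf b < lam" using cf_le[OF cof] by simp
  show "C \<inter> {..<b} \<in> family b"
  proof (cases "a \<le> lam")
    case True
    then have "C = {..<a}" using C unfolding family_def by simp
    then have "C \<inter> {..<b} = {..<b}" using ba by auto
    moreover have "b \<le> lam" using True ba by simp
    ultimately show ?thesis unfolding family_def by simp
  next
    case False
    then have Cl: "C \<subseteq> {lam..}" using fc(3) by simp
    \<comment> \<open>An element of \<open>C\<close> below \<open>b\<close> is already at least
      \<open>lam\<close>, so \<open>b\<close> falls under the clauses of \<open>family\<close> for
      points above \<open>lam\<close>.\<close>
    obtain y where "y \<in> C" "y < b" using bC(2) unfolding limit_of_def by blast
    then have lamb: "lam < b" using Cl by auto
    have "club_in (C \<inter> {..<b}) b"
      unfolding club_in_iff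
    proof (intro conjI cof allI impI)
      fix x assume x: "x < b" "limit_of (C \<inter> {..<b}) x"
      have "limit_of C x" using x(2) by (rule limit_of_mono) blast
      moreover have "x < a" using x(1) ba by simp
      ultimately show "x \<in> C \<inter> {..<b}" using fc(1) x(1) unfolding club_in_iff by blast
    qed
    then have "C \<inter> {..<b} \<in> small_clubs b" using Cl otp unfolding small_clubs_def by auto
    then show ?thesis using lamb cfb unfolding family_def by auto
  qed
qed

lemma card_family:
  assumes pow: "lt_self_power lam =o |{..<lam}|" and a: "limit_of UNIV a" "a < kappa"
  shows "|family a| \<le>o |{..<a}|"
proof (cases "lam < a \<and> cf a \<noteq> lam")
  case True
  then have "family a \<subseteq> {C. C \<subseteq> {..<a} \<and> otp C < lam}"
    unfolding family_def small_clubs_def club_in_def cofinal_in_def by auto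
  then have "|family a| \<le>o |{C. C \<subseteq> {..<a} \<and> otp C < lam}|" by (rule card_of_mono1)
  also have "|{C. C \<subseteq> {..<a} \<and> otp C < lam}| \<le>o |{..<a}|"
    using card_small_subsets[OF pow _ a(2)] True less_imp_le by blast
  finally show ?thesis .
next
  case False
  then have "family a = {if a \<le> lam then {..<a} else c a}" unfolding family_def by auto
  then obtain x where x: "family a = {x}" by blast
  have "{..<a} \<noteq> {}" using a(1) unfolding limit_of_def by auto
  then show ?thesis unfolding x by (rule card_of_singl_ordLeq)
qed

text \<open>Both claims are instances, with \<open>G\<close> a selection of one club per point for
  the first and all of \<open>family\<close> for the second. At points of cofinality
  \<open>lam\<close> above \<open>lam\<close> the family is \<open>{c a}\<close>, so guessing
  depends on \<open>c\<close> alone.\<close>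

lemma P_minus_subfamily:
  assumes G: "\<And>a. limit_of UNIV a \<Longrightarrow> a < kappa \<Longrightarrow> G a \<subseteq> family a \<and> width_ok mu a (G a)"
    and R: "\<And>a C b. limit_of UNIV a \<Longrightarrow> a < kappa \<Longrightarrow> C \<in> G a \<Longrightarrow> b \<in> acc_pts C \<Longrightarrow> \<exists>D\<in>G b. R D C"
    and S: "S \<subseteq> E_cof kappa lam"
    and guess: "\<And>B. cofinal_in B kappa \<Longrightarrow>
      \<exists>D. club_in D kappa \<and> (\<forall>a\<in>D \<inter> S. B \<inter> {..<a} \<in> \<A> a)"
    and hit: "\<And>a A s b. a \<in> S \<Longrightarrow> limit_of UNIV a \<Longrightarrow> lam < a \<Longrightarrow> A \<in> \<A> a \<Longrightarrow> cofinal_in A a \<Longrightarrow>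
      s < lam \<Longrightarrow> b < a \<Longrightarrow> \<exists>g\<in>c a. b < g \<and> succ_set s (c a - {..<g}) \<subseteq> A"
  shows "P_minus lam kappa mu R {S'. S' \<subseteq> S \<and> stationary_in S' kappa}"
  unfolding P_minus_def
proof (rule exI[of _ G], intro conjI ballI allI impI)
  fix a assume "a \<in> acc_pts {..<kappa}"
  then have a: "limit_of UNIV a" "a < kappa" unfolding acc_pts_lessThan by auto
  show "G a \<subseteq> {C \<in> K_sets kappa. otp C \<le> lam \<and> osup C = a}"
    using G[OF a] family_club[OF a] club_in_K_sets[OF a] by blast
  show "width_ok mu a (G a)" using G[OF a] by blast
  show "\<exists>D\<in>G b. R D C" if "C \<in> G a" "b \<in> acc_pts C" for C b using R[OF a that] .
next
  fix B S' assume "cofinal_in B kappa \<and> S' \<in> {S'. S' \<subseteq> S \<and> stationary_in S' kappa}"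
  then have B: "cofinal_in B kappa" and S': "S' \<subseteq> S" "stationary_in S' kappa" by auto
  let ?H = "{a \<in> S'. card (G a) = 1 \<and> (\<forall>C\<in>G a. \<forall>s < otp C.
              osup {g \<in> C. succ_set s (C - {..<g}) \<subseteq> B} = a)}"
  obtain D where D: "club_in D kappa" "\<forall>a\<in>D \<inter> S. B \<inter> {..<a} \<in> \<A> a" using guess[OF B] by blast
  show "stationary_in ?H kappa"
    unfolding stationary_in_def
  proof (intro conjI allI impI)
    show "?H \<subseteq> {..<kappa}" using S'(2) unfolding stationary_in_def by blast
    fix E assume E: "club_in E kappa"
    have "cofinal_in E kappa" "cofinal_in D kappa" using E D(1) unfolding club_in_def by auto
    \<comment> \<open>Limits of \<open>E\<close> and \<open>D\<close> belong to these clubs; being a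
      limit of \<open>B\<close> makes \<open>B \<inter> {..<a}\<close> cofinal in \<open>a\<close>,
      as \<open>hit\<close> requires.\<close>
    from common_limits_club[OF this B lam_less_kappa] S'(2)
    obtain a where a: "a \<in> S'" "lam < a" "a < kappa" "limit_of E a" "limit_of D a" "limit_of B a"
      unfolding stationary_in_def by blast
    have lim: "limit_of UNIV a" using a(4) by (rule limit_of_UNIV)
    have aE: "a \<in> E" using E a unfolding club_in_iff by blast
    have aD: "a \<in> D" using D(1) a unfolding club_in_iff by blast
    have aS: "a \<in> S" using a(1) S'(1) by blast
    then have cfa: "cf a = lam" using S unfolding E_cof_def by blast
    have fam: "family a = {c a}" using a(2) cfa unfolding family_def by auto
    moreover have "G a \<noteq> {}" "G a \<subseteq> family a" using G[OF lim a(3)] unfolding width_ok_def by auto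
    ultimately have Ga: "G a = {c a}" by (simp add: subset_singleton_iff)
    have cofB: "cofinal_in (B \<inter> {..<a}) a"
      unfolding cofinal_in_limit_iff[OF lim] 
      by (intro conjI limit_of_mono[OF a(6)]) simp_all
    have BA: "B \<inter> {..<a} \<in> \<A> a" using D(2) aD aS by blast
    have ca: "club_in (c a) a" "otp (c a) \<le> lam" using family_club[OF lim a(3), of "c a"] fam by auto
    have "osup {g \<in> c a. succ_set s (c a - {..<g}) \<subseteq> B} = a" if "s < otp (c a)" for s
    proof (rule osup_eqI)
      show "x \<le> a" if "x \<in> {g \<in> c a. succ_set s (c a - {..<g}) \<subseteq> B}" for x
        using that ca(1) unfolding club_in_def cofinal_in_def by auto
      have s: "s < lam" using that ca(2) by simp
      show "\<exists>x\<in>{g \<in> c a. succ_set s (c a - {..<g}) \<subseteq> B}. b < x" if "b < a" for b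
        using hit[OF aS lim a(2) BA cofB s that] by blast
    qed
    then have "a \<in> ?H" using a(1) Ga by simp
    then show "?H \<inter> E \<noteq> {}" using aE by blast
  qed
qed

end

theorem theorem4p35:
  fixes lam kappa :: "'o::wellorder" and S :: "'o set"
  assumes "regular_infinite_cardinal lam"
    and "is_succ_cardinal lam kappa"
    and "S \<subseteq> E_cof kappa lam"
    and "stationary_in S kappa"
    and "diamond_star kappa S"
  shows "P_minus lam kappa (Some (osuc (osuc ozero)))
           (end_ext_below lam (E_cof kappa lam)) {S'. S' \<subseteq> S \<and> stationary_in S' kappa}
       \<and> (lt_self_power lam =o |{..<lam}| \<longrightarrow>
          P_minus lam kappa None
           (end_ext (E_cof kappa lam)) {S'. S' \<subseteq> S \<and> stationary_in S' kappa})"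
proof -
  interpret succ: successor_of_regular lam kappa using assms(1,2) by unfold_locales
  obtain \<A> where \<A>: "\<forall>a\<in>S. |\<A> a| \<le>o |{..<a}|"
    and guess: "\<forall>A. A \<subseteq> {..<kappa} \<longrightarrow>
           (\<exists>D. club_in D kappa \<and> (\<forall>a\<in>D \<inter> S. A \<inter> {..<a} \<in> \<A> a))"
    using assms(5) unfolding diamond_star_def by blast
  have guess': "\<exists>D. club_in D kappa \<and> (\<forall>a\<in>D \<inter> S. B \<inter> {..<a} \<in> \<A> a)" if "cofinal_in B kappa" for B
    using guess that unfolding cofinal_in_def by blast
  \<comment> \<open>The guessing clause is conditional on \<open>a \<in> S\<close>: a ladder is
    wanted at every point of cofinality \<open>lam\<close> above \<open>lam\<close>, whereas the
    diamond speaks only of points in \<open>S\<close>.\<close>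
  define good where "good a C \<longleftrightarrow> club_in C a \<and> C \<subseteq> {lam..} \<and> otp C \<le> lam \<and>
    (a \<in> S \<longrightarrow> (\<forall>A\<in>\<A> a. cofinal_in A a \<longrightarrow> (\<forall>s<lam. \<forall>b<a.
       \<exists>g\<in>C. b < g \<and> succ_set s (C - {..<g}) \<subseteq> A)))" for a C
  have "\<exists>C. good a C" if a: "limit_of UNIV a" "lam < a" "a < kappa" "cf a = lam" for a
  proof -
    define \<A>' where "\<A>' = (if a \<in> S then \<A> a else {})"
    have "|\<A>'| \<le>o |{..<a}|" using \<A> card_of_empty unfolding \<A>'_def by auto
    from succ.guessing_club[OF a(1,3,4,2) this] obtain C where
      C: "club_in C a" "C \<subseteq> {lam..}" "otp C \<le> lam"
      "\<And>A s b. A \<in> \<A>' \<Longrightarrow> cofinal_in A a \<Longrightarrow> s < lam \<Longrightarrow> b < a \<Longrightarrow>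
         \<exists>g\<in>C. b < g \<and> succ_set s (C - {..<g}) \<subseteq> A"
      by blast
    then have "good a C" unfolding good_def \<A>'_def by simp
    then show ?thesis by blast
  qed
  then obtain c where good: "\<And>a. limit_of UNIV a \<Longrightarrow> lam < a \<Longrightarrow> a < kappa \<Longrightarrow> cf a = lam \<Longrightarrow> good a (c a)"
    by metis
  have c: "club_in (c a) a \<and> c a \<subseteq> {lam..} \<and> otp (c a) \<le> lam"
    if "limit_of UNIV a" "lam < a" "a < kappa" "cf a = lam" for a
    using good[OF that] unfolding good_def by blast
  have hit: "\<exists>g\<in>c a. b < g \<and> succ_set s (c a - {..<g}) \<subseteq> A"
    if "a \<in> S" "limit_of UNIV a" "lam < a" "A \<in> \<A> a" "cofinal_in A a" "s < lam" "b < a" for a A s b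
  proof -
    have "a < kappa" "cf a = lam" using that(1) assms(3) unfolding E_cof_def by auto
    then show ?thesis using good[OF that(2,3)] that unfolding good_def by blast
  qed
  interpret ladder_family lam kappa c by unfold_locales (rule c)
  \<comment> \<open>The weak coherence relation tolerates an arbitrary selection of one club at each
    point.\<close>
  define G where "G a = {SOME C. C \<in> family a}" for a
  have G: "G a \<subseteq> family a" if "limit_of UNIV a" "a < kappa" for a
    using family_nonempty[OF that] unfolding G_def by (simp add: some_in_eq)
  show ?thesis
  proof (intro conjI impI)
    show "P_minus lam kappa (Some (osuc (osuc ozero)))
           (end_ext_below lam (E_cof kappa lam)) {S'. S' \<subseteq> S \<and> stationary_in S' kappa}"
    proof (rule P_minus_subfamily[where G = G and S = S and \<A> = \<A>])
      show "S \<subseteq> E_cof kappa lam" by (rule assms(3))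
      show "\<exists>D. club_in D kappa \<and> (\<forall>a\<in>D \<inter> S. B \<inter> {..<a} \<in> \<A> a)" if "cofinal_in B kappa" for B
        using guess'[OF that] .
      show "\<exists>g\<in>c a. b < g \<and> succ_set s (c a - {..<g}) \<subseteq> A"
        if "a \<in> S" "limit_of UNIV a" "lam < a" "A \<in> \<A> a" "cofinal_in A a" "s < lam" "b < a" for a A s b
        using hit[OF that] .
      fix a assume a: "limit_of UNIV a" "a < kappa"
      show "G a \<subseteq> family a \<and> width_ok (Some (osuc (osuc ozero))) a (G a)"
        using G[OF a] succ.singleton_less_two unfolding width_ok_def by (simp add: G_def)
      fix C b assume Cb: "C \<in> G a" "b \<in> acc_pts C"
      then have "C \<in> family a" using G[OF a] by blast
      note coh = family_coherent[OF a this Cb(2)]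
      have bk: "b < kappa" using coh(5) a(2) by simp
      obtain D where D: "D \<in> G b" unfolding G_def by blast
      then have "D \<in> family b" using G[OF coh(4) bk] by blast
      then have "osup D = b"
        using family_club(1)[OF coh(4) bk] club_in_K_sets(2)[OF coh(4) bk] by blast
      \<comment> \<open>\<open>cf b < lam\<close> gives the second disjunct whichever club
        \<open>D\<close> was selected at \<open>b\<close>, and also places \<open>b\<close> outside
        \<open>E_cof kappa lam\<close>.\<close>
      then have "end_ext_below lam (E_cof kappa lam) D C"
        using coh(3) unfolding end_ext_below_def E_cof_def by auto
      then show "\<exists>D\<in>G b. end_ext_below lam (E_cof kappa lam) D C" using D by blast
    qed
  next
    assume pow: "lt_self_power lam =o |{..<lam}|"
    show "P_minus lam kappa None
           (end_ext (E_cof kappa lam)) {S'. S' \<subseteq> S \<and> stationary_in S' kappa}"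
    proof (rule P_minus_subfamily[where G = family and S = S and \<A> = \<A>])
      show "S \<subseteq> E_cof kappa lam" by (rule assms(3))
      show "\<exists>D. club_in D kappa \<and> (\<forall>a\<in>D \<inter> S. B \<inter> {..<a} \<in> \<A> a)" if "cofinal_in B kappa" for B
        using guess'[OF that] .
      show "\<exists>g\<in>c a. b < g \<and> succ_set s (c a - {..<g}) \<subseteq> A"
        if "a \<in> S" "limit_of UNIV a" "lam < a" "A \<in> \<A> a" "cofinal_in A a" "s < lam" "b < a" for a A s b
        using hit[OF that] .
      fix a assume a: "limit_of UNIV a" "a < kappa"
      show "family a \<subseteq> family a \<and> width_ok None a (family a)"
        using family_nonempty[OF a] card_family[OF pow a] unfolding width_ok_def by simp
      fix C b assume Cb: "C \<in> family a" "b \<in> acc_pts C"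
      note coh = family_coherent[OF a Cb]
      have "end_ext (E_cof kappa lam) (C \<inter> {..<b}) C"
        using coh(2,3) unfolding end_ext_def E_cof_def by auto
      then show "\<exists>D\<in>family b. end_ext (E_cof kappa lam) D C" using coh(1) by blast
    qed
  qed
qed

end
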